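(* There exists an absolute constant $c>0$ such that the following holds. Let $K\subset\mathbb{R}^n$ be a (nonempty, closed) star-shaped set, assume that $x\in K$, and let the observations be $$y_i=\langle a_i,x\rangle+\varepsilon_i,\quad i=1,\dots,m,$$ where $a_1,\dots,a_m$ are independent standard normal vectors in $\mathbb{R}^n$ and $\varepsilon_i\sim N(0,\nu^2)$ are independent of each other and of the $a_i$. Let $$\delta^* := \inf_{t>0}\Big\{t+\frac{\nu}{\sqrt{m}}\Big[1+\frac{w_t(K)}{t}\Big]\Big\},\qquad \alpha=\alpha(K)=\sup_{t>0}\frac{w_t(K)}{t\sqrt{\log P_t}}.$$ Then any estimator $\widehat{x}$ depending only on the $y_i$ and $a_i$ satisfies $$\sup_{x\in K}\mathbb{E}\,\|\widehat{x}-x\|_2\ge c_\alpha\,\min(\delta^*,\mathrm{diam}(K)),\qquad c_\alpha=c/\alpha.$$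
   Context: A set $K$ is star-shaped if $\lambda K\subseteq K$ for all $0\le\lambda\le1$. $\nu>0$ is the noise level. An estimator is a measurable function of $(a_1,\dots,a_m,y_1,\dots,y_m)$ with values in $\mathbb{R}^n$. $B_2^n$ is the Euclidean unit ball and $\mathrm{diam}$ is the Euclidean diameter (possibly $+\infty$). The local mean width is $w_t(K)=\mathbb{E}\sup\{\langle g,u-v\rangle:u,v\in K,\ \|u-v\|_2\le t\}$, $g\sim N(0,I_n)$. Given $T\subset\mathbb{R}^n$ and $r>0$, a packing of $T$ with balls of radius $r$ is a set $\mathcal{X}\subset T$ with $\|v-w\|_2\ge r$ for each pair of distinct $v,w\in\mathcal{X}$; the packing number is the cardinality of the largest such packing. The local packing number $P_t$ of $K$ is the packing number of $K\cap tB_2^n$ with balls of radius $t/10$. Convention: the ratio $w_t(K)/(t\sqrt{\log P_t})$ is $+\infty$ when $P_t=1$; if $\alpha=\infty$ then $c_\alpha=0$ and the product $c_\alpha\min(\delta^*,\mathrm{diam}(K))$ is $0$. *)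

theory Defs
  imports "HOL-Probability.Probability"
begin

text \<open>
  The constant in the theorem is independent of the dimension \<open>n\<close>, so \<open>n\<close> has to be a
  quantified variable rather than a type. The space \<open>\<real>\<^sup>n\<close> is therefore the set of extensional
  functions \<open>{..<n} \<rightarrow>\<^sub>E UNIV\<close>, which is both the space of the product measure
  \<open>Pi\<^sub>M {..<n} (\<lambda>_. borel)\<close> and the topspace of \<open>powertop_real {..<n}\<close>. Indices start at \<open>0\<close>.
\<close>

definition inner_n :: "nat \<Rightarrow> (nat \<Rightarrow> real) \<Rightarrow> (nat \<Rightarrow> real) \<Rightarrow> real" where
  "inner_n n u v = (\<Sum>i<n. u i * v i)"

definition norm_n :: "nat \<Rightarrow> (nat \<Rightarrow> real) \<Rightarrow> real" where
  "norm_n n u = L2_set u {..<n}"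

definition diff_n :: "nat \<Rightarrow> (nat \<Rightarrow> real) \<Rightarrow> (nat \<Rightarrow> real) \<Rightarrow> (nat \<Rightarrow> real)" where
  "diff_n n u v = (\<lambda>i\<in>{..<n}. u i - v i)"

definition scale_n :: "nat \<Rightarrow> real \<Rightarrow> (nat \<Rightarrow> real) \<Rightarrow> (nat \<Rightarrow> real)" where
  "scale_n n r u = (\<lambda>i\<in>{..<n}. r * u i)"

definition star_shaped :: "nat \<Rightarrow> (nat \<Rightarrow> real) set \<Rightarrow> bool" where
  "star_shaped n K \<longleftrightarrow> (\<forall>r. 0 \<le> r \<and> r \<le> 1 \<longrightarrow> scale_n n r ` K \<subseteq> K)"

text \<open>The diameter takes values in \<open>[0, \<infinity>]\<close>; the library's \<open>diameter\<close> is \<open>0\<close> on unbounded sets.\<close>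

definition diam_n :: "nat \<Rightarrow> (nat \<Rightarrow> real) set \<Rightarrow> ennreal" where
  "diam_n n K = (SUP u\<in>K. SUP v\<in>K. ennreal (norm_n n (diff_n n u v)))"

text \<open>The law \<open>N(0, \<sigma>\<^sup>2 I\<^sub>n)\<close>; the parameter \<open>\<sigma>\<close> is the standard deviation.\<close>

definition gaussian_n :: "nat \<Rightarrow> real \<Rightarrow> (nat \<Rightarrow> real) measure" where
  "gaussian_n n \<sigma> = Pi\<^sub>M {..<n} (\<lambda>_. density lborel (normal_density 0 \<sigma>))"

text \<open>
  For nonempty \<open>K\<close> and \<open>t > 0\<close> the set below contains \<open>0\<close> and is bounded by \<open>t * norm_n n g\<close>,
  so the real supremum and the Bochner integral are the intended finite quantities.
\<close>

definition local_mean_width :: "nat \<Rightarrow> (nat \<Rightarrow> real) set \<Rightarrow> real \<Rightarrow> real" where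
  "local_mean_width n K t =
     (\<integral>g. Sup {inner_n n g (diff_n n u v) | u v.
              u \<in> K \<and> v \<in> K \<and> norm_n n (diff_n n u v) \<le> t} \<partial>gaussian_n n 1)"

definition packing :: "nat \<Rightarrow> (nat \<Rightarrow> real) set \<Rightarrow> real \<Rightarrow> (nat \<Rightarrow> real) set \<Rightarrow> bool" where
  "packing n T r X \<longleftrightarrow>
     X \<subseteq> T \<and> (\<forall>v\<in>X. \<forall>w\<in>X. v \<noteq> w \<longrightarrow> norm_n n (diff_n n v w) \<ge> r)"

text \<open>
  Only used for bounded \<open>T \<subseteq> \<real>\<^sup>n\<close> and \<open>r > 0\<close>. Then all packings are finite with uniformly
  bounded cardinality, and the supremum in \<open>nat\<close> is a maximum.
\<close>

definition packing_number :: "nat \<Rightarrow> (nat \<Rightarrow> real) set \<Rightarrow> real \<Rightarrow> nat" where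
  "packing_number n T r = Sup (card ` {X. packing n T r X})"

definition local_packing_number :: "nat \<Rightarrow> (nat \<Rightarrow> real) set \<Rightarrow> real \<Rightarrow> nat" where
  "local_packing_number n K t = packing_number n {u \<in> K. norm_n n u \<le> t} (t / 10)"

definition width_packing_ratio :: "nat \<Rightarrow> (nat \<Rightarrow> real) set \<Rightarrow> real \<Rightarrow> ennreal" where
  "width_packing_ratio n K t =
     (if local_packing_number n K t = 1 then \<infinity>
      else ennreal (local_mean_width n K t / (t * sqrt (ln (real (local_packing_number n K t))))))"

definition \<alpha>_ratio :: "nat \<Rightarrow> (nat \<Rightarrow> real) set \<Rightarrow> ennreal" where
  "\<alpha>_ratio n K = (SUP t\<in>{0<..}. width_packing_ratio n K t)"

definition \<delta>_star :: "nat \<Rightarrow> nat \<Rightarrow> real \<Rightarrow> (nat \<Rightarrow> real) set \<Rightarrow> real" where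
  "\<delta>_star n m \<nu> K =
     (INF t\<in>{0<..}. t + \<nu> / sqrt (real m) * (1 + local_mean_width n K t / t))"

text \<open>The joint law of \<open>((a\<^sub>i)\<^sub>i, (\<epsilon>\<^sub>i)\<^sub>i)\<close>: everything is independent.\<close>

definition design_noise :: "nat \<Rightarrow> nat \<Rightarrow> real \<Rightarrow> ((nat \<Rightarrow> nat \<Rightarrow> real) \<times> (nat \<Rightarrow> real)) measure" where
  "design_noise n m \<nu> = Pi\<^sub>M {..<m} (\<lambda>_. gaussian_n n 1) \<Otimes>\<^sub>M gaussian_n m \<nu>"

definition observations ::
  "nat \<Rightarrow> nat \<Rightarrow> (nat \<Rightarrow> real) \<Rightarrow> (nat \<Rightarrow> nat \<Rightarrow> real) \<Rightarrow> (nat \<Rightarrow> real) \<Rightarrow> (nat \<Rightarrow> real)" where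
  "observations n m x a e = (\<lambda>i\<in>{..<m}. inner_n n (a i) x + e i)"

definition estimator ::
  "nat \<Rightarrow> nat \<Rightarrow> ((nat \<Rightarrow> nat \<Rightarrow> real) \<times> (nat \<Rightarrow> real) \<Rightarrow> (nat \<Rightarrow> real)) \<Rightarrow> bool" where
  "estimator n m xhat \<longleftrightarrow>
     xhat \<in> Pi\<^sub>M {..<m} (\<lambda>_. Pi\<^sub>M {..<n} (\<lambda>_. borel)) \<Otimes>\<^sub>M Pi\<^sub>M {..<m} (\<lambda>_. borel)
            \<rightarrow>\<^sub>M Pi\<^sub>M {..<n} (\<lambda>_. borel)"

definition expected_error ::
  "nat \<Rightarrow> nat \<Rightarrow> real \<Rightarrow> ((nat \<Rightarrow> nat \<Rightarrow> real) \<times> (nat \<Rightarrow> real) \<Rightarrow> (nat \<Rightarrow> real)) \<Rightarrow>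
     (nat \<Rightarrow> real) \<Rightarrow> ennreal" where
  "expected_error n m \<nu> xhat x =
     (\<integral>\<^sup>+(a, e). ennreal (norm_n n (diff_n n (xhat (a, observations n m x a e)) x))
        \<partial>design_noise n m \<nu>)"

text \<open>
  The conventions \<open>c\<^sub>\<alpha> = 0\<close> for \<open>\<alpha> = \<infinity>\<close> and \<open>0 \<cdot> \<infinity> = 0\<close> are those of division and
  multiplication on \<^typ>\<open>ennreal\<close>. For nonempty star-shaped \<open>K\<close> one always has \<open>\<alpha> > 0\<close>: if some
  \<open>P\<^sub>t\<close> exceeds \<open>1\<close>, then \<open>K\<close> contains two distinct points and all its local mean widths are
  positive.
\<close>

definition c_alpha :: "real \<Rightarrow> nat \<Rightarrow> (nat \<Rightarrow> real) set \<Rightarrow> ennreal" where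
  "c_alpha c n K = ennreal c / \<alpha>_ratio n K"

end

theory Submission
  imports Defs
begin

text \<open>
  Finding \<open>x\<close> is at least as hard as deciding which point of a packing it is. Suppose \<open>\<alpha> < \<infinity>\<close>, so that
  \<open>P\<^sub>t \<ge> 2\<close> for all \<open>t\<close>. Take a maximal packing of \<open>K \<inter> t B\<close> with separation \<open>t / 10\<close>. As long as
  \<open>t \<le> (\<nu> / (8 sqrt m)) sqrt (ln P\<^sub>t)\<close>, the noise hides the true point of the packing, and every
  estimator errs by a multiple of \<open>t\<close> for some \<open>x\<close> (\<open>minimax_packing_bound\<close>). By doubling one finds a
  radius \<open>t\<close> that satisfies this condition while \<open>2 t\<close> violates it (\<open>critical_radius_exists\<close>). Since
  \<open>w\<^sub>s / s \<le> \<alpha> sqrt (ln P\<^sub>s)\<close>, evaluating the infimum \<open>\<delta>\<^sup>*\<close> at \<open>s = 2 t\<close> shows that \<open>\<delta>\<^sup>*\<close> is at most a constant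
  times \<open>(1 + \<alpha>) t\<close>. To replace \<open>1 + \<alpha>\<close> by a multiple of \<open>\<alpha>\<close> one needs an absolute lower bound for
  \<open>\<alpha>\<close>, and this is Sudakov's inequality \<open>w\<^sub>t \<ge> t sqrt (ln P\<^sub>t) / 4000\<close> (\<open>sudakov_minoration_local\<close>).

  Both the minimax bound and Sudakov's inequality come from one fact about Gaussian shifts
  (\<open>gaussian_testing_bound\<close>): if \<open>N \<ge> 2\<close> shifts of a Gaussian vector have length at most
  \<open>\<sigma> sqrt (ln N) / 2\<close>, no test identifies the shift with average probability above \<open>4 / 5\<close>. For the
  minimax bound the shifts are the noiseless observations of the packing points. For Sudakov's
  inequality they are rescaled packing points, and the test is maximum likelihood, whose failure
  needs a large increment of the Gaussian process.

  For finite \<open>\<alpha>\<close> the set \<open>K \<inter> t B\<close> contains, for every \<open>t\<close>, two points at distance \<open>t / 10\<close> or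
  more. So \<open>K\<close> is unbounded and the minimum of \<open>\<delta>\<^sup>*\<close> and the diameter is \<open>\<delta>\<^sup>*\<close>.
\<close>

section \<open>Testing between shifts of a Gaussian vector\<close>

lemma sets_gaussian_n [measurable_cong]:
  "sets (gaussian_n n \<sigma>) = sets (Pi\<^sub>M {..<n} (\<lambda>_. borel))"
  unfolding gaussian_n_def by (intro sets_PiM_cong) auto

lemma space_gaussian_n: "space (gaussian_n n \<sigma>) = {..<n} \<rightarrow>\<^sub>E UNIV"
  by (simp add: gaussian_n_def space_PiM)

lemma prob_space_gaussian_n:
  assumes "\<sigma> > 0" shows "prob_space (gaussian_n n \<sigma>)"
  unfolding gaussian_n_def using assms by (intro prob_space_PiM prob_space_normal_density)

text \<open>
  The density of \<open>N(b, \<sigma>\<^sup>2 I)\<close> with respect to \<open>N(0, \<sigma>\<^sup>2 I)\<close>, kept as a product over the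
  coordinates so that it can be integrated against a product measure factor by factor.
\<close>
definition likelihood_ratio :: "nat \<Rightarrow> real \<Rightarrow> (nat \<Rightarrow> real) \<Rightarrow> (nat \<Rightarrow> real) \<Rightarrow> real" where
  "likelihood_ratio n \<sigma> b y = (\<Prod>k<n. exp ((2 * b k * y k - (b k)\<^sup>2) / (2 * \<sigma>\<^sup>2)))"

lemma likelihood_ratio_nonneg: "likelihood_ratio n \<sigma> b y \<ge> 0"
  unfolding likelihood_ratio_def by (intro prod_nonneg) auto

lemma measurable_likelihood_ratio [measurable]:
  "likelihood_ratio n \<sigma> b \<in> borel_measurable (Pi\<^sub>M {..<n} (\<lambda>_. borel))"
  unfolding likelihood_ratio_def by measurable

lemma measurable_shift [measurable]:
  "(\<lambda>e. \<lambda>k\<in>{..<n}. b k + e k) \<in> Pi\<^sub>M {..<n} (\<lambda>_. borel) \<rightarrow>\<^sub>M Pi\<^sub>M {..<n} (\<lambda>_. borel :: real measure)"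
  by measurable

lemma normal_density_shift:
  assumes "\<sigma> > 0"
  shows "normal_density b \<sigma> y = normal_density 0 \<sigma> y * exp ((2 * b * y - b\<^sup>2) / (2 * \<sigma>\<^sup>2))"
  using assms
  by (simp add: normal_density_def flip: exp_add)
     (simp add: power2_diff algebra_simps flip: add_divide_distrib)

text \<open>
  The Cameron--Martin formula in finite dimension. Both sides are the product of the one-dimensional
  laws \<open>N(b k, \<sigma>\<^sup>2)\<close>, as one sees on boxes: on the left by translation invariance of Lebesgue
  measure in each coordinate, on the right by the one-dimensional density.
\<close>
lemma distr_gaussian_n_shift:
  assumes \<sigma>: "\<sigma> > 0"
  shows "distr (gaussian_n n \<sigma>) (Pi\<^sub>M {..<n} (\<lambda>_. borel)) (\<lambda>e. \<lambda>k\<in>{..<n}. b k + e k)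
       = density (gaussian_n n \<sigma>) (\<lambda>y. ennreal (likelihood_ratio n \<sigma> b y))"
    (is "?L = ?R")
proof -
  let ?N = "\<lambda>\<mu>. density lborel (normal_density \<mu> \<sigma>)"
  interpret G: product_prob_space "\<lambda>_. ?N 0" "{..<n}"
    by (intro product_prob_spaceI prob_space_normal_density \<sigma>)
  interpret B: product_prob_space "\<lambda>k. ?N (b k)" "{..<n}"
    by (intro product_prob_spaceI prob_space_normal_density \<sigma>)
  have setsB: "sets (Pi\<^sub>M {..<n} (\<lambda>k. ?N (b k))) = sets (Pi\<^sub>M {..<n} (\<lambda>_. borel))"
    by (intro sets_PiM_cong) auto
  have L: "?L = Pi\<^sub>M {..<n} (\<lambda>k. ?N (b k))"
  proof (rule B.PiM_eqI)
    show "sets ?L = sets (Pi\<^sub>M {..<n} (\<lambda>k. ?N (b k)))" by (simp add: setsB)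
    fix A assume A: "\<And>i. i \<in> {..<n} \<Longrightarrow> A i \<in> sets (?N (b i))"
    then have [measurable]: "\<And>i. i < n \<Longrightarrow> A i \<in> sets borel" by auto
    have "emeasure ?L (Pi\<^sub>E {..<n} A) =
        emeasure (gaussian_n n \<sigma>) (Pi\<^sub>E {..<n} (\<lambda>k. {e. b k + e \<in> A k}))"
    proof (subst emeasure_distr)
      show "Pi\<^sub>E {..<n} A \<in> sets (Pi\<^sub>M {..<n} (\<lambda>_. borel))"
        by (rule sets_PiM_I_finite) auto
      have "(\<lambda>e. \<lambda>k\<in>{..<n}. b k + e k) -` Pi\<^sub>E {..<n} A \<inter> space (gaussian_n n \<sigma>)
          = Pi\<^sub>E {..<n} (\<lambda>k. {e. b k + e \<in> A k})"
        unfolding space_gaussian_n by (force simp: PiE_iff)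
      then show "emeasure (gaussian_n n \<sigma>)
          ((\<lambda>e. \<lambda>k\<in>{..<n}. b k + e k) -` Pi\<^sub>E {..<n} A \<inter> space (gaussian_n n \<sigma>)) =
          emeasure (gaussian_n n \<sigma>) (Pi\<^sub>E {..<n} (\<lambda>k. {e. b k + e \<in> A k}))" by simp
    qed measurable
    also have "\<dots> = (\<Prod>k<n. emeasure (?N 0) {e. b k + e \<in> A k})"
      unfolding gaussian_n_def by (intro G.emeasure_PiM) auto
    also have "\<dots> = (\<Prod>k<n. emeasure (?N (b k)) (A k))"
    proof (intro prod.cong refl)
      fix k assume "k \<in> {..<n}"
      then have [measurable]: "A k \<in> sets borel" by auto
      have "emeasure (?N (b k)) (A k) = (\<integral>\<^sup>+x. ennreal (normal_density (b k) \<sigma> x) * indicator (A k) x \<partial>lborel)"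
        by (simp add: emeasure_density)
      also have "\<dots> = (\<integral>\<^sup>+x. ennreal (normal_density (b k) \<sigma> (b k + 1 * x)) * indicator (A k) (b k + 1 * x) \<partial>lborel)"
        by (subst nn_integral_real_affine[where c=1 and t="b k"]) auto
      also have "\<dots> = emeasure (?N 0) {e. b k + e \<in> A k}"
        by (simp add: emeasure_density normal_density_def indicator_def)
      finally show "emeasure (?N 0) {e. b k + e \<in> A k} = emeasure (?N (b k)) (A k)" ..
    qed
    finally show "emeasure ?L (Pi\<^sub>E {..<n} A) = (\<Prod>i<n. emeasure (?N (b i)) (A i))" .
  qed auto
  have meas_L: "(\<lambda>y. ennreal (likelihood_ratio n \<sigma> b y)) \<in> borel_measurable (gaussian_n n \<sigma>)"
    by measurable
  have "?R = Pi\<^sub>M {..<n} (\<lambda>k. ?N (b k))"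
  proof (rule B.PiM_eqI)
    show "sets ?R = sets (Pi\<^sub>M {..<n} (\<lambda>k. ?N (b k)))" by (simp add: setsB sets_gaussian_n)
    fix A assume A: "\<And>i. i \<in> {..<n} \<Longrightarrow> A i \<in> sets (?N (b i))"
    then have [measurable]: "\<And>i. i < n \<Longrightarrow> A i \<in> sets borel" by auto
    let ?f = "\<lambda>k y. ennreal (exp ((2 * b k * y - (b k)\<^sup>2) / (2 * \<sigma>\<^sup>2))) * indicator (A k) y"
    have box: "Pi\<^sub>E {..<n} A \<in> sets (gaussian_n n \<sigma>)"
      unfolding sets_gaussian_n by (rule sets_PiM_I_finite) auto
    have "emeasure ?R (Pi\<^sub>E {..<n} A) =
        (\<integral>\<^sup>+y. ennreal (likelihood_ratio n \<sigma> b y) * indicator (Pi\<^sub>E {..<n} A) y \<partial>gaussian_n n \<sigma>)"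
      by (rule emeasure_density[OF meas_L box])
    also have "\<dots> = (\<integral>\<^sup>+y. (\<Prod>k<n. ?f k (y k)) \<partial>gaussian_n n \<sigma>)"
    proof (rule nn_integral_cong)
      fix y assume "y \<in> space (gaussian_n n \<sigma>)"
      then have ext: "y \<in> extensional {..<n}" by (simp add: space_gaussian_n PiE_def)
      have "indicator (Pi\<^sub>E {..<n} A) y = (\<Prod>k<n. indicator (A k) (y k) :: ennreal)"
      proof (cases "y \<in> Pi\<^sub>E {..<n} A")
        case False
        then obtain k where "k < n" "y k \<notin> A k" using ext by (auto simp: PiE_iff)
        then have "(\<Prod>k<n. indicator (A k) (y k) :: ennreal) = 0"
          by (intro prod_zero) (auto intro!: bexI[of _ k])
        with False show ?thesis by simp
      next
        case True
        then have "\<forall>k\<in>{..<n}. indicator (A k) (y k) = (1::ennreal)" by (simp add: PiE_iff)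
        then have "(\<Prod>k<n. indicator (A k) (y k) :: ennreal) = 1" by (rule prod.neutral)
        with True show ?thesis by simp
      qed
      then show "ennreal (likelihood_ratio n \<sigma> b y) * indicator (Pi\<^sub>E {..<n} A) y = (\<Prod>k<n. ?f k (y k))"
        by (simp add: likelihood_ratio_def prod_ennreal prod.distrib)
    qed
    also have "\<dots> = (\<Prod>k<n. \<integral>\<^sup>+y. ?f k y \<partial>?N 0)"
      unfolding gaussian_n_def by (rule G.product_nn_integral_prod) auto
    also have "\<dots> = (\<Prod>k<n. emeasure (?N (b k)) (A k))"
      by (intro prod.cong refl)
         (auto simp: nn_integral_density emeasure_density normal_density_shift[OF \<sigma>, of "b _"]
             ennreal_mult' mult.assoc intro!: nn_integral_cong)
    finally show "emeasure ?R (Pi\<^sub>E {..<n} A) = (\<Prod>i<n. emeasure (?N (b i)) (A i))" .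
  qed auto
  with L show ?thesis by simp
qed

lemma nn_integral_likelihood_ratio:
  assumes \<sigma>: "\<sigma> > 0"
  shows "(\<integral>\<^sup>+y. ennreal (likelihood_ratio n \<sigma> b y) \<partial>gaussian_n n \<sigma>) = 1"
proof -
  interpret prob_space "gaussian_n n \<sigma>" by (rule prob_space_gaussian_n[OF \<sigma>])
  interpret D: prob_space "distr (gaussian_n n \<sigma>) (Pi\<^sub>M {..<n} (\<lambda>_. borel)) (\<lambda>e. \<lambda>k\<in>{..<n}. b k + e k)"
    by (rule prob_space_distr) measurable
  have "(\<integral>\<^sup>+y. ennreal (likelihood_ratio n \<sigma> b y) \<partial>gaussian_n n \<sigma>) =
      emeasure (density (gaussian_n n \<sigma>) (\<lambda>y. ennreal (likelihood_ratio n \<sigma> b y))) (space (gaussian_n n \<sigma>))"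
    by (subst emeasure_density) (auto intro!: nn_integral_cong)
  also have "\<dots> = 1"
    using D.emeasure_space_1 by (simp add: distr_gaussian_n_shift[OF \<sigma>])
  finally show ?thesis .
qed

text \<open>
  Completing the square: squaring the density of the shift by \<open>b\<close> gives, up to a constant factor,
  the density of the shift by \<open>2 b\<close>. Hence the second moment of the likelihood ratio under
  \<open>N(0, \<sigma>\<^sup>2 I)\<close> is exactly \<open>exp (\<parallel>b\<parallel>\<^sup>2 / \<sigma>\<^sup>2)\<close>.
\<close>
lemma likelihood_ratio_square:
  "(likelihood_ratio n \<sigma> b y)\<^sup>2 =
     exp ((\<Sum>k<n. (b k)\<^sup>2) / \<sigma>\<^sup>2) * likelihood_ratio n \<sigma> (\<lambda>k. 2 * b k) y"
proof -
  have "(exp ((2 * b k * y k - (b k)\<^sup>2) / (2 * \<sigma>\<^sup>2)))\<^sup>2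
      = exp ((b k)\<^sup>2 / \<sigma>\<^sup>2) * exp ((2 * (2 * b k) * y k - (2 * b k)\<^sup>2) / (2 * \<sigma>\<^sup>2))" for k
    by (simp add: power2_eq_square diff_divide_distrib flip: exp_add)
  then show ?thesis
    by (simp add: likelihood_ratio_def prod_power_distrib prod.distrib sum_divide_distrib exp_sum)
qed

text \<open>
  A test that has to tell \<open>N\<close> shifts apart succeeds on average with probability at most
  \<open>exp D / sqrt N\<close>, a second-moment substitute for Fano's inequality. The reason: the likelihood
  ratios \<open>L i\<close> satisfy \<open>L i \<le> s / 2 + (L i)\<^sup>2 / (2 s)\<close>. Integrated over the disjoint decision
  regions, the first terms contribute at most \<open>s / 2\<close> in total, because the regions share the unit
  mass of one common reference measure; the second terms contribute at most \<open>N exp (2 D) / (2 s)\<close>.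
\<close>
lemma gaussian_testing_bound:
  fixes b :: "'i \<Rightarrow> nat \<Rightarrow> real"
  assumes \<sigma>: "\<sigma> > 0" and I: "finite I"
    and A: "\<And>i. i \<in> I \<Longrightarrow> A i \<in> sets (Pi\<^sub>M {..<n} (\<lambda>_. borel))"
    and disj: "disjoint_family_on A I"
    and D: "\<And>i. i \<in> I \<Longrightarrow> (\<Sum>k<n. (b i k)\<^sup>2) \<le> 2 * D * \<sigma>\<^sup>2"
  shows "(\<Sum>i\<in>I. measure (gaussian_n n \<sigma>)
            {e \<in> space (gaussian_n n \<sigma>). (\<lambda>k\<in>{..<n}. b i k + e k) \<in> A i})
         \<le> sqrt (real (card I)) * exp D"
proof (cases "I = {}")
  case False
  let ?G = "gaussian_n n \<sigma>" and ?L = "\<lambda>i. likelihood_ratio n \<sigma> (b i)"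
  interpret prob_space ?G by (rule prob_space_gaussian_n[OF \<sigma>])
  \<comment> \<open>this choice makes the two contributions \<open>s / 2\<close> and \<open>N exp (2 D) / (2 s)\<close> equal\<close>
  define s where "s = sqrt (real (card I)) * exp D"
  have card: "card I > 0" using False I by (simp add: card_gt_0_iff)
  then have s: "s > 0" by (simp add: s_def)
  have AM: "?L i y \<le> s / 2 + (?L i y)\<^sup>2 / (2 * s)" for i y
    using s zero_le_power2[of "?L i y - s"] by (simp add: field_simps power2_eq_square)
  have int1: "integrable ?G (likelihood_ratio n \<sigma> c)"
       and int2: "(\<integral>y. likelihood_ratio n \<sigma> c y \<partial>?G) = 1" for c
  proof -
    have "has_bochner_integral ?G (likelihood_ratio n \<sigma> c) 1"
      by (rule has_bochner_integral_nn_integral)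
         (auto simp: likelihood_ratio_nonneg nn_integral_likelihood_ratio[OF \<sigma>])
    then show "integrable ?G (likelihood_ratio n \<sigma> c)" "(\<integral>y. likelihood_ratio n \<sigma> c y \<partial>?G) = 1"
      by (auto simp: has_bochner_integral_iff)
  qed
  have each: "measure ?G {e \<in> space ?G. (\<lambda>k\<in>{..<n}. b i k + e k) \<in> A i}
      \<le> s / 2 * measure ?G (A i) + exp (2 * D) / (2 * s)" if i: "i \<in> I" for i
  proof -
    note [measurable] = A[OF i]
    have inA: "A i \<in> sets ?G" using A[OF i] by (simp add: sets_gaussian_n)
    have "emeasure ?G {e \<in> space ?G. (\<lambda>k\<in>{..<n}. b i k + e k) \<in> A i}
       = emeasure (distr ?G (Pi\<^sub>M {..<n} (\<lambda>_. borel)) (\<lambda>e. \<lambda>k\<in>{..<n}. b i k + e k)) (A i)"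
      by (subst emeasure_distr) (auto intro!: arg_cong[where f="emeasure _"])
    also have "\<dots> = (\<integral>\<^sup>+y. ennreal (?L i y) * indicator (A i) y \<partial>?G)"
      unfolding distr_gaussian_n_shift[OF \<sigma>] by (rule emeasure_density) (use inA in auto)
    also have "\<dots> \<le> (\<integral>\<^sup>+y. ennreal (s / 2 * indicator (A i) y
        + exp ((\<Sum>k<n. (b i k)\<^sup>2) / \<sigma>\<^sup>2) / (2 * s) * likelihood_ratio n \<sigma> (\<lambda>k. 2 * b i k) y) \<partial>?G)"
    proof (intro nn_integral_mono)
      fix y
      have "?L i y * indicator (A i) y \<le> s / 2 * indicator (A i) y + (?L i y)\<^sup>2 / (2 * s)"
        using AM[of i y] s by (auto simp: indicator_def)
      also have "(?L i y)\<^sup>2 / (2 * s) =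
          exp ((\<Sum>k<n. (b i k)\<^sup>2) / \<sigma>\<^sup>2) / (2 * s) * likelihood_ratio n \<sigma> (\<lambda>k. 2 * b i k) y"
        by (simp add: likelihood_ratio_square)
      finally have "ennreal (?L i y * indicator (A i) y) \<le> ennreal (s / 2 * indicator (A i) y
        + exp ((\<Sum>k<n. (b i k)\<^sup>2) / \<sigma>\<^sup>2) / (2 * s) * likelihood_ratio n \<sigma> (\<lambda>k. 2 * b i k) y)"
        by (rule ennreal_leI)
      then show "ennreal (?L i y) * indicator (A i) y \<le> ennreal (s / 2 * indicator (A i) y
        + exp ((\<Sum>k<n. (b i k)\<^sup>2) / \<sigma>\<^sup>2) / (2 * s) * likelihood_ratio n \<sigma> (\<lambda>k. 2 * b i k) y)"
        by (auto simp: indicator_def split: if_splits)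
    qed
    also have "\<dots> = ennreal (\<integral>y. (s / 2 * indicator (A i) y
        + exp ((\<Sum>k<n. (b i k)\<^sup>2) / \<sigma>\<^sup>2) / (2 * s) * likelihood_ratio n \<sigma> (\<lambda>k. 2 * b i k) y) \<partial>?G)"
      using inA s
      by (intro nn_integral_eq_integral Bochner_Integration.integrable_add integrable_mult_right int1
            AE_I2 integrable_real_indicator)
         (auto simp: likelihood_ratio_nonneg less_top[symmetric])
    also have "(\<integral>y. (s / 2 * indicator (A i) y
        + exp ((\<Sum>k<n. (b i k)\<^sup>2) / \<sigma>\<^sup>2) / (2 * s) * likelihood_ratio n \<sigma> (\<lambda>k. 2 * b i k) y) \<partial>?G)
       = s / 2 * measure ?G (A i) + exp ((\<Sum>k<n. (b i k)\<^sup>2) / \<sigma>\<^sup>2) / (2 * s)"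
      using inA
      by (subst Bochner_Integration.integral_add;
          (intro integrable_mult_right int1 integrable_real_indicator)?)
         (auto simp: int2 less_top[symmetric])
    finally have "measure ?G {e \<in> space ?G. (\<lambda>k\<in>{..<n}. b i k + e k) \<in> A i}
        \<le> s / 2 * measure ?G (A i) + exp ((\<Sum>k<n. (b i k)\<^sup>2) / \<sigma>\<^sup>2) / (2 * s)"
      by (subst (asm) emeasure_eq_measure, subst (asm) ennreal_le_iff) (use s in auto)
    also have "\<dots> \<le> s / 2 * measure ?G (A i) + exp (2 * D) / (2 * s)"
      using D[OF i] \<sigma> s by (intro add_left_mono divide_right_mono) (auto simp: divide_le_eq)
    finally show ?thesis .
  qed
  have "(\<Sum>i\<in>I. measure ?G {e \<in> space ?G. (\<lambda>k\<in>{..<n}. b i k + e k) \<in> A i})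
      \<le> (\<Sum>i\<in>I. s / 2 * measure ?G (A i) + exp (2 * D) / (2 * s))"
    by (rule sum_mono) (rule each)
  also have "\<dots> = s / 2 * (\<Sum>i\<in>I. measure ?G (A i)) + real (card I) * exp (2 * D) / (2 * s)"
    by (simp add: sum.distrib sum_distrib_left)
  also have "(\<Sum>i\<in>I. measure ?G (A i)) = measure ?G (\<Union>i\<in>I. A i)"
    using A disj I by (intro finite_measure_finite_Union[symmetric]) (auto simp: sets_gaussian_n)
  also have "s / 2 * measure ?G (\<Union>i\<in>I. A i) + real (card I) * exp (2 * D) / (2 * s)
      \<le> s / 2 * 1 + real (card I) * exp (2 * D) / (2 * s)"
    using s by (intro add_right_mono mult_left_mono) auto
  also have "\<dots> = s / 2 + s\<^sup>2 / (2 * s)"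
    by (simp add: s_def power_mult_distrib flip: exp_double)
  also have "\<dots> = s" using s by (simp add: power2_eq_square)
  finally show ?thesis unfolding s_def .
qed simp

section \<open>Euclidean geometry and Gaussian moments in coordinates\<close>
lemma norm_n_nonneg [simp]: "norm_n n u \<ge> 0"
  by (simp add: norm_n_def L2_set_nonneg)

lemma norm_n_power2: "(norm_n n u)\<^sup>2 = (\<Sum>i<n. (u i)\<^sup>2)"
  by (simp add: norm_n_def L2_set_def sum_nonneg)

lemma norm_n_diff_commute: "norm_n n (diff_n n u v) = norm_n n (diff_n n v u)"
  by (simp add: norm_n_def L2_set_def diff_n_def power2_commute)

lemma norm_n_diff_triangle:
  "norm_n n (diff_n n u w) \<le> norm_n n (diff_n n u v) + norm_n n (diff_n n v w)"
proof -
  have "norm_n n (diff_n n u w) = L2_set (\<lambda>i. diff_n n u v i + diff_n n v w i) {..<n}"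
    unfolding norm_n_def by (intro L2_set_cong) (auto simp: diff_n_def)
  then show ?thesis using L2_set_triangle_ineq[of "diff_n n u v" "diff_n n v w" "{..<n}"]
    by (simp add: norm_n_def)
qed

lemma norm_n_diff_le: "norm_n n (diff_n n u v) \<le> norm_n n u + norm_n n v"
proof -
  have "norm_n n (diff_n n u (\<lambda>_. 0)) = norm_n n u" "norm_n n (diff_n n (\<lambda>_. 0) v) = norm_n n v"
    by (simp_all add: norm_n_def L2_set_def diff_n_def)
  then show ?thesis using norm_n_diff_triangle[of n u v "\<lambda>_. 0"] by simp
qed

lemma norm_n_scale: "norm_n n (scale_n n r u) = \<bar>r\<bar> * norm_n n u"
proof -
  have "norm_n n (scale_n n r u) = sqrt (r\<^sup>2 * (\<Sum>i<n. (u i)\<^sup>2))"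
    by (simp add: norm_n_def L2_set_def scale_n_def power_mult_distrib sum_distrib_left)
  then show ?thesis
    by (simp add: norm_n_def L2_set_def real_sqrt_mult)
qed

lemma inner_n_le_norm: "inner_n n u v \<le> norm_n n u * norm_n n v"
proof -
  have "inner_n n u v \<le> (\<Sum>i<n. \<bar>u i\<bar> * \<bar>v i\<bar>)"
    unfolding inner_n_def by (intro sum_mono) (metis abs_ge_self abs_mult)
  also have "\<dots> \<le> norm_n n u * norm_n n v"
    unfolding norm_n_def by (rule L2_set_mult_ineq)
  finally show ?thesis .
qed

lemma measurable_norm_n [measurable]:
  "norm_n n \<in> borel_measurable (Pi\<^sub>M {..<n} (\<lambda>_. borel))"
  unfolding norm_n_def L2_set_def by measurable

lemma measurable_inner_n [measurable]:
  "(\<lambda>g. inner_n n g d) \<in> borel_measurable (Pi\<^sub>M {..<n} (\<lambda>_. borel))"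
  unfolding inner_n_def by measurable

lemma has_bochner_integral_std_normal:
  "has_bochner_integral (density lborel std_normal_density) (\<lambda>x. x) 0"
  "has_bochner_integral (density lborel std_normal_density) (\<lambda>x. x * x) 1"
  "has_bochner_integral (density lborel std_normal_density) (\<lambda>x. 1) (1::real)"
  using std_normal_moment_odd[of 0] std_normal_moment_even[of 1] std_normal_moment_even[of 0]
  by (auto intro!: has_bochner_integral_density simp: power2_eq_square)

text \<open>
  Fubini, applied to the product over all coordinates \<open>k\<close> of a factor which is \<open>g k\<close>, \<open>(g k)\<^sup>2\<close> or
  \<open>1\<close> according to how often \<open>k\<close> occurs among \<open>i\<close>, \<open>j\<close>.
\<close>
lemma has_bochner_integral_gaussian_component_product:
  assumes "i < n" "j < n"
  shows "has_bochner_integral (gaussian_n n 1) (\<lambda>g. g i * g j) (if i = j then 1 else 0)"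
proof -
  let ?N = "density lborel std_normal_density"
  interpret G: product_prob_space "\<lambda>_. ?N" "{..<n}"
    by (intro product_prob_spaceI prob_space_normal_density) simp
  define f :: "nat \<Rightarrow> real \<Rightarrow> real"
    where "f k y = (if k = i then y else 1) * (if k = j then y else 1)" for k y
  have f: "has_bochner_integral ?N (f k) (if (k = i) = (k = j) then 1 else 0)" for k
    using has_bochner_integral_std_normal unfolding f_def
    by (cases "k = i"; cases "k = j") auto
  have prod: "(\<Prod>k<n. f k (g k)) = g i * g j" for g
    using assms by (simp add: f_def prod.distrib)
  have "(\<Prod>k<n. if (k = i) = (k = j) then 1 else (0::real)) = (if i = j then 1 else 0)"
    using assms by (auto intro!: prod_zero bexI[of _ i])
  then show ?thesis
    using f G.product_integrable_prod[of "{..<n}" f] G.product_integral_prod[of "{..<n}" f]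
    unfolding gaussian_n_def has_bochner_integral_iff by (simp add: prod)
qed

lemma nn_integral_gaussian_inner_square:
  "(\<integral>\<^sup>+g. ennreal ((inner_n n g x)\<^sup>2) \<partial>gaussian_n n 1) = ennreal ((norm_n n x)\<^sup>2)"
proof -
  have "has_bochner_integral (gaussian_n n 1)
      (\<lambda>g. \<Sum>i<n. \<Sum>j<n. (x i * x j) * (g i * g j)) (\<Sum>i<n. \<Sum>j<n. (x i * x j) * (if i = j then 1 else 0))"
    by (intro has_bochner_integral_sum has_bochner_integral_mult_right
        has_bochner_integral_gaussian_component_product) auto
  also have "(\<lambda>g. \<Sum>i<n. \<Sum>j<n. (x i * x j) * (g i * g j)) = (\<lambda>g. (inner_n n g x)\<^sup>2)"
    by (simp add: inner_n_def power2_eq_square sum_product mult_ac)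
  also have "(\<Sum>i<n. \<Sum>j<n. (x i * x j) * (if i = j then 1 else 0)) = (norm_n n x)\<^sup>2"
    unfolding norm_n_power2 by (simp add: power2_eq_square if_distrib cong: if_cong)
  finally have *: "has_bochner_integral (gaussian_n n 1) (\<lambda>g. (inner_n n g x)\<^sup>2) ((norm_n n x)\<^sup>2)" .
  then show ?thesis
    by (subst nn_integral_eq_integral) (auto simp: has_bochner_integral_iff)
qed

lemma integrable_norm_gaussian: "integrable (gaussian_n n 1) (norm_n n)"
proof -
  interpret prob_space "gaussian_n n 1" by (rule prob_space_gaussian_n) simp
  have *: "integrable (gaussian_n n 1) (\<lambda>g. 1 + (\<Sum>i<n. g i * g i))"
    using has_bochner_integral_gaussian_component_product
    by (intro Bochner_Integration.integrable_add Bochner_Integration.integrable_sum)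
       (auto simp: has_bochner_integral_iff)
  show ?thesis
  proof (rule Bochner_Integration.integrable_bound[OF *])
    show "norm_n n \<in> borel_measurable (gaussian_n n 1)" by measurable
    have "norm_n n g \<le> 1 + (norm_n n g)\<^sup>2" for g
    proof -
      have "0 \<le> (norm_n n g - 1)\<^sup>2" by simp
      then have "2 * norm_n n g \<le> 1 + (norm_n n g)\<^sup>2" by (simp add: power2_diff)
      then show ?thesis using norm_n_nonneg[of n g] by linarith
    qed
    then have "norm_n n g \<le> 1 + (\<Sum>i<n. g i * g i)" for g
      unfolding norm_n_power2 by (simp add: power2_eq_square)
    then show "AE g in gaussian_n n 1. norm (norm_n n g) \<le> norm (1 + (\<Sum>i<n. g i * g i))"
      by (intro AE_I2) (simp add: order_trans[OF _ abs_ge_self])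
  qed
qed

section \<open>The local mean width\<close>
definition increments :: "nat \<Rightarrow> (nat \<Rightarrow> real) set \<Rightarrow> real \<Rightarrow> (nat \<Rightarrow> real) set" where
  "increments n K t = {diff_n n u v | u v. u \<in> K \<and> v \<in> K \<and> norm_n n (diff_n n u v) \<le> t}"

definition width_sup :: "nat \<Rightarrow> (nat \<Rightarrow> real) set \<Rightarrow> real \<Rightarrow> (nat \<Rightarrow> real) \<Rightarrow> real" where
  "width_sup n K t g = (SUP d\<in>increments n K t. inner_n n g d)"

lemma local_mean_width_eq: "local_mean_width n K t = (\<integral>g. width_sup n K t g \<partial>gaussian_n n 1)"
proof -
  have "{inner_n n g (diff_n n u v) | u v. u \<in> K \<and> v \<in> K \<and> norm_n n (diff_n n u v) \<le> t}
      = inner_n n g ` increments n K t" for g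
    by (auto simp: increments_def)
  then show ?thesis by (simp add: local_mean_width_def width_sup_def)
qed

lemma inner_increment_le:
  assumes "d \<in> increments n K t" shows "inner_n n g d \<le> t * norm_n n g"
proof -
  have "norm_n n d \<le> t" using assms by (auto simp: increments_def)
  then have "norm_n n g * norm_n n d \<le> norm_n n g * t" by (intro mult_left_mono) auto
  then show ?thesis using inner_n_le_norm[of n g d] by (simp add: mult.commute)
qed

lemma bdd_above_inner_increments: "bdd_above (inner_n n g ` increments n K t)"
  using inner_increment_le by (fastforce intro: bdd_aboveI)

lemma zero_increment:
  assumes "K \<noteq> {}" "t \<ge> 0" shows "(\<lambda>i\<in>{..<n}. 0) \<in> increments n K t"
proof -
  obtain u where "u \<in> K" using assms by auto
  moreover have "diff_n n u u = (\<lambda>i\<in>{..<n}. 0)" by (auto simp: diff_n_def)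
  moreover have "norm_n n (\<lambda>i\<in>{..<n}. 0) = 0" by (simp add: norm_n_def L2_set_def)
  ultimately show ?thesis using assms unfolding increments_def by fastforce
qed

lemma width_sup_upper:
  "d \<in> increments n K t \<Longrightarrow> inner_n n g d \<le> width_sup n K t g"
  unfolding width_sup_def by (rule cSUP_upper[OF _ bdd_above_inner_increments])

lemma width_sup_nonneg:
  assumes "K \<noteq> {}" "t \<ge> 0" shows "width_sup n K t g \<ge> 0"
  using width_sup_upper[OF zero_increment[OF assms], of n g] by (simp add: inner_n_def)

lemma width_sup_le:
  assumes "K \<noteq> {}" "t \<ge> 0" shows "width_sup n K t g \<le> t * norm_n n g"
  unfolding width_sup_def using zero_increment[OF assms, of n] inner_increment_le
  by (intro cSUP_least) auto

text \<open>
  The index set of the supremum may be uncountable. A countable dense subset gives the same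
  supremum, because the inner product is continuous in the increment.
\<close>
lemma measurable_width_sup [measurable]:
  "width_sup n K t \<in> borel_measurable (Pi\<^sub>M {..<n} (\<lambda>_. borel))"
proof (cases "increments n K t = {}")
  case True
  then have "width_sup n K t = (\<lambda>_. Sup {})" by (auto simp: width_sup_def)
  then show ?thesis by simp
next
  case False
  obtain T where T: "countable T" "T \<subseteq> increments n K t" "increments n K t \<subseteq> closure T"
    by (rule separable)
  with False have "T \<noteq> {}" by auto
  have "width_sup n K t g = (SUP d\<in>T. inner_n n g d)" for g
  proof (rule antisym)
    have bdd: "bdd_above (inner_n n g ` T)"
      by (rule bdd_above_mono[OF bdd_above_inner_increments]) (use T in blast)
    have "closed {d. inner_n n g d \<le> (SUP d\<in>T. inner_n n g d)}"
      unfolding inner_n_def by (intro closed_Collect_le continuous_intros continuous_on_product_coordinates)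
    moreover have "T \<subseteq> {d. inner_n n g d \<le> (SUP d\<in>T. inner_n n g d)}"
      using cSUP_upper[OF _ bdd] by auto
    ultimately have "closure T \<subseteq> {d. inner_n n g d \<le> (SUP d\<in>T. inner_n n g d)}"
      by (rule closure_minimal[rotated])
    then show "width_sup n K t g \<le> (SUP d\<in>T. inner_n n g d)"
      unfolding width_sup_def using T False by (intro cSUP_least) auto
    show "(SUP d\<in>T. inner_n n g d) \<le> width_sup n K t g"
      using T \<open>T \<noteq> {}\<close> by (intro cSUP_least width_sup_upper) auto
  qed
  moreover have "bdd_above (inner_n n g ` T)" for g
    by (rule bdd_above_mono[OF bdd_above_inner_increments]) (use T in blast)
  then have "(\<lambda>g. SUP d\<in>T. inner_n n g d) \<in> borel_measurable (Pi\<^sub>M {..<n} (\<lambda>_. borel))"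
    using T(1) by (intro borel_measurable_cSUP) auto
  ultimately show ?thesis by (subst measurable_cong) auto
qed

lemma integrable_width_sup:
  assumes "K \<noteq> {}" "t \<ge> 0" shows "integrable (gaussian_n n 1) (width_sup n K t)"
proof (rule Bochner_Integration.integrable_bound)
  show "integrable (gaussian_n n 1) (\<lambda>g. t * norm_n n g)"
    by (intro integrable_mult_right integrable_norm_gaussian)
  show "width_sup n K t \<in> borel_measurable (gaussian_n n 1)" by measurable
  show "AE g in gaussian_n n 1. norm (width_sup n K t g) \<le> norm (t * norm_n n g)"
    using width_sup_nonneg[OF assms] width_sup_le[OF assms] assms by (intro AE_I2) auto
qed

lemma local_mean_width_nonneg:
  assumes "K \<noteq> {}" "t \<ge> 0" shows "local_mean_width n K t \<ge> 0"
  unfolding local_mean_width_eq by (intro integral_nonneg_AE AE_I2 width_sup_nonneg assms)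

lemma local_mean_width_le:
  assumes "K \<noteq> {}" "t \<ge> 0"
  shows "local_mean_width n K t \<le> t * (\<integral>g. norm_n n g \<partial>gaussian_n n 1)"
proof -
  have "local_mean_width n K t \<le> (\<integral>g. t * norm_n n g \<partial>gaussian_n n 1)"
    unfolding local_mean_width_eq
    by (intro integral_mono integrable_width_sup integrable_mult_right integrable_norm_gaussian
        width_sup_le assms)
  then show ?thesis by simp
qed

section \<open>Local Sudakov minoration\<close>
text \<open>
  With \<open>D = ln N / 8\<close> the average success probability of \<open>gaussian_testing_bound\<close> is at most
  \<open>N powr (- 3 / 8)\<close>, which already for \<open>N = 2\<close> is bounded away from \<open>1\<close>.
\<close>
lemma sqrt_exp_ln_bound:
  assumes "N \<ge> 2" shows "sqrt N * exp (ln N / 8) \<le> 4 / 5 * N"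
proof -
  define q where "q = exp (- (3 / 8) * ln N)"
  have "sqrt N = exp (ln N / 2)"
    using assms by (simp add: ln_sqrt[symmetric])
  then have "sqrt N * exp (ln N / 8) = exp (- (3 / 8) * ln N + ln N)"
    by (simp flip: exp_add)
  also have "\<dots> = q * N"
    using assms unfolding exp_add q_def by simp
  finally have eq: "sqrt N * exp (ln N / 8) = q * N" .
  have "q ^ 8 = exp (- 3 * ln N)"
    by (simp add: q_def flip: exp_of_nat_mult)
  also have "\<dots> \<le> exp (- 3 * ln 2)" using assms by simp
  also have "\<dots> = 1 / 8"
  proof -
    have "exp (3 * ln 2 :: real) = exp (ln 2) ^ 3" using exp_of_nat_mult[of 3 "ln 2 :: real"] by simp
    then show ?thesis by (simp add: exp_minus)
  qed
  also have "\<dots> \<le> (4 / 5) ^ 8" by (simp add: power_divide)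
  finally have "q \<le> 4 / 5"
    by (rule power_le_imp_le_base[where n = 7, simplified]) simp
  then show ?thesis unfolding eq using assms by (intro mult_right_mono) auto
qed

text \<open>
  Sudakov's inequality for packings whose radius and separation are comparable, derived from the
  testing bound instead of Gaussian comparison. Observe one of the points \<open>b x = \<kappa> x\<close> in standard
  Gaussian noise \<open>g\<close> and pick the point of largest likelihood. This errs only if
  \<open>\<langle>g, b z - b x\<rangle> \<ge> \<parallel>b z - b x\<parallel>\<^sup>2 / 2\<close> for some \<open>z\<close>, which forces the supremum defining the mean width
  to be at least \<open>\<theta>\<close>. Were the mean width much smaller than \<open>\<theta>\<close>, then by Markov's inequality the
  choice would nearly always be right, more often than the testing bound permits.
\<close>
lemma sudakov_minoration_local:
  assumes star: "star_shaped n K" and t: "t > 0"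
    and X: "packing n {u \<in> K. norm_n n u \<le> t} (t / 10) X" "finite X" "card X \<ge> 2"
  shows "t * sqrt (ln (real (card X))) / 4000 \<le> local_mean_width n K t"
proof -
  let ?G = "gaussian_n n 1"
  interpret prob_space ?G by (rule prob_space_gaussian_n) simp
  define N where "N = real (card X)"
  have N: "N \<ge> 2" using X by (simp add: N_def)
  define L where "L = sqrt (ln N)"
  have L: "L > 0" "L\<^sup>2 = ln N" using N by (auto simp: L_def)
  \<comment> \<open>the largest scale at which the testing bound applies with \<open>D = ln N / 8\<close>\<close>
  define \<kappa> where "\<kappa> = L / (2 * t)"
  have \<kappa>: "\<kappa> > 0" "\<kappa> * t = L / 2" using L t by (auto simp: \<kappa>_def)
  define \<theta> where "\<theta> = t * L / 800"
  have \<theta>: "\<theta> > 0" using L t by (simp add: \<theta>_def)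
  have XK: "x \<in> K" "norm_n n x \<le> t" if "x \<in> X" for x using X that by (auto simp: packing_def)
  have sep: "norm_n n (diff_n n x z) \<ge> t / 10" if "x \<in> X" "z \<in> X" "x \<noteq> z" for x z
    using X that by (auto simp: packing_def)
  have "X \<noteq> {}" using X by auto
  then have K: "K \<noteq> {}" using XK by auto
  define b where "b x k = \<kappa> * x k" for x :: "nat \<Rightarrow> real" and k
  define score where "score x y = inner_n n y (b x) - (\<Sum>k<n. (b x k)\<^sup>2) / 2" for x y
  define A where "A x = {y \<in> space (Pi\<^sub>M {..<n} (\<lambda>_. borel)). \<forall>z\<in>X - {x}. score z y < score x y}" for x
  have A_sets: "A x \<in> sets (Pi\<^sub>M {..<n} (\<lambda>_. borel))" for x
  proof -
    have "score z \<in> borel_measurable (Pi\<^sub>M {..<n} (\<lambda>_. borel))" for z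
      unfolding score_def by (intro borel_measurable_diff measurable_inner_n borel_measurable_const)
    then show ?thesis
      unfolding A_def using X(2) by (intro sets.sets_Collect_finite_All borel_measurable_less) auto
  qed
  have bound: "(\<Sum>x\<in>X. measure ?G {e \<in> space ?G. (\<lambda>k\<in>{..<n}. b x k + e k) \<in> A x})
      \<le> sqrt (real (card X)) * exp (ln N / 8)"
  proof (rule gaussian_testing_bound)
    show "A x \<in> sets (Pi\<^sub>M {..<n} (\<lambda>_. borel))" for x by (rule A_sets)
    show "disjoint_family_on A X"
      unfolding disjoint_family_on_def
    proof (intro ballI impI equals0I)
      fix x z y assume xz: "x \<in> X" "z \<in> X" "x \<noteq> z" and y: "y \<in> A x \<inter> A z"
      have "score z y < score x y" "score x y < score z y" using xz y by (simp_all add: A_def)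
      then show False by simp
    qed
    fix x assume x: "x \<in> X"
    have "(\<Sum>k<n. (b x k)\<^sup>2) = \<kappa>\<^sup>2 * (norm_n n x)\<^sup>2"
      by (simp add: norm_n_power2 b_def power_mult_distrib sum_distrib_left)
    also have "\<dots> \<le> \<kappa>\<^sup>2 * t\<^sup>2"
      using XK[OF x] by (intro mult_left_mono power_mono) auto
    also have "\<dots> = (L / 2)\<^sup>2" unfolding \<kappa>(2)[symmetric] by (simp add: power_mult_distrib)
    also have "\<dots> = 2 * (ln N / 8) * 1\<^sup>2" by (simp add: power_divide L)
    finally show "(\<Sum>k<n. (b x k)\<^sup>2) \<le> 2 * (ln N / 8) * 1\<^sup>2" .
  qed (use X in auto)
  have recover: "(\<lambda>k\<in>{..<n}. b x k + e k) \<in> A x"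
    if x: "x \<in> X" and small: "width_sup n K t e < \<theta>" for x e
  proof -
    let ?y = "\<lambda>k\<in>{..<n}. b x k + e k"
    have "score z ?y < score x ?y" if z: "z \<in> X - {x}" for z
    proof -
      have z': "z \<in> X" "z \<noteq> x" using z by auto
      \<comment> \<open>Points of the packing may be \<open>2 t\<close> apart; halving them, which \<open>K\<close> permits as a
          star-shaped set, turns their difference into an admissible increment.\<close>
      let ?d = "diff_n n (scale_n n (1 / 2) z) (scale_n n (1 / 2) x)"
      have d: "?d = scale_n n (1 / 2) (diff_n n z x)"
        by (auto simp: diff_n_def scale_n_def fun_eq_iff diff_divide_distrib)
      have "norm_n n ?d \<le> t"
        unfolding d norm_n_scale using norm_n_diff_le[of n z x] XK[OF x] XK[OF z'(1)] by simp
      moreover have "scale_n n (1 / 2) z \<in> K" "scale_n n (1 / 2) x \<in> K"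
        using star XK[OF x] XK[OF z'(1)] by (auto simp: star_shaped_def image_subset_iff)
      ultimately have "?d \<in> increments n K t" unfolding increments_def by blast
      then have "inner_n n e ?d < \<theta>"
        using width_sup_upper[of ?d n K t e] small by linarith
      then have "2 * \<kappa> * inner_n n e ?d < 2 * \<kappa> * \<theta>" using \<kappa> by simp
      also have "2 * \<kappa> * inner_n n e ?d = (\<Sum>k<n. e k * (b z k - b x k))"
        by (simp add: d inner_n_def scale_n_def diff_n_def b_def sum_distrib_left algebra_simps)
      finally have noise: "(\<Sum>k<n. e k * (b z k - b x k)) < 2 * \<kappa> * \<theta>" .
      have "2 * \<kappa> * \<theta> = (\<kappa> * (t / 10))\<^sup>2 / 2"
        using \<kappa>(2) by (simp add: \<theta>_def power2_eq_square)
      also have "\<dots> \<le> (\<kappa> * norm_n n (diff_n n x z))\<^sup>2 / 2"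
        using sep[OF x z'(1)] z' \<kappa> t by (intro divide_right_mono power_mono mult_left_mono) auto
      also have "(\<kappa> * norm_n n (diff_n n x z))\<^sup>2 = (\<Sum>k<n. (b x k - b z k)\<^sup>2)"
        by (simp add: power_mult_distrib norm_n_power2 b_def diff_n_def sum_distrib_left
            flip: right_diff_distrib)
      finally have signal: "2 * \<kappa> * \<theta> \<le> (\<Sum>k<n. (b x k - b z k)\<^sup>2) / 2" .
      have "score x ?y - score z ?y =
          (\<Sum>k<n. (b x k + e k) * b x k - (b x k)\<^sup>2 / 2 - ((b x k + e k) * b z k - (b z k)\<^sup>2 / 2))"
        by (simp add: score_def inner_n_def sum_subtractf sum_divide_distrib)
      also have "\<dots> = (\<Sum>k<n. (b x k - b z k)\<^sup>2 / 2 - e k * (b z k - b x k))"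
        by (intro sum.cong refl) (simp add: power2_eq_square field_simps)
      also have "\<dots> = (\<Sum>k<n. (b x k - b z k)\<^sup>2) / 2 - (\<Sum>k<n. e k * (b z k - b x k))"
        by (simp add: sum_subtractf sum_divide_distrib)
      finally show ?thesis using noise signal by linarith
    qed
    then show ?thesis by (simp add: A_def space_PiM)
  qed
  have "N * measure ?G {g \<in> space ?G. width_sup n K t g < \<theta>}
      = (\<Sum>x\<in>X. measure ?G {g \<in> space ?G. width_sup n K t g < \<theta>})"
    by (simp add: N_def)
  also have "\<dots> \<le> (\<Sum>x\<in>X. measure ?G {e \<in> space ?G. (\<lambda>k\<in>{..<n}. b x k + e k) \<in> A x})"
  proof (intro sum_mono finite_measure_mono)
    fix x assume "x \<in> X"
    show "{g \<in> space ?G. width_sup n K t g < \<theta>} \<subseteq> {e \<in> space ?G. (\<lambda>k\<in>{..<n}. b x k + e k) \<in> A x}"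
      using recover[OF \<open>x \<in> X\<close>] by auto
    note [measurable] = A_sets[of x]
    show "{e \<in> space ?G. (\<lambda>k\<in>{..<n}. b x k + e k) \<in> A x} \<in> sets ?G" by measurable
  qed
  also note bound
  also have "sqrt (real (card X)) * exp (ln N / 8) \<le> 4 / 5 * N"
    using sqrt_exp_ln_bound[OF N] by (simp add: N_def)
  finally have small: "measure ?G {g \<in> space ?G. width_sup n K t g < \<theta>} \<le> 4 / 5" using N by simp
  have "1 - measure ?G {g \<in> space ?G. width_sup n K t g < \<theta>} = measure ?G {g \<in> space ?G. \<theta> \<le> width_sup n K t g}"
    by (subst prob_compl[symmetric]) (auto intro!: arg_cong[where f = "measure ?G"])
  also have "\<dots> \<le> local_mean_width n K t / \<theta>"
    unfolding local_mean_width_eq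
    by (rule integral_Markov_inequality_measure[where A = "space ?G"])
       (use integrable_width_sup[OF K] width_sup_nonneg[OF K] t \<theta> in auto)
  finally have "1 / 5 \<le> local_mean_width n K t / \<theta>" using small by linarith
  then have "\<theta> / 5 \<le> local_mean_width n K t" using \<theta> by (simp add: field_simps)
  then show ?thesis by (simp add: \<theta>_def L_def N_def)
qed

section \<open>A lower bound for the risk on a packing\<close>
lemma prob_space_design:
  "prob_space (Pi\<^sub>M {..<m} (\<lambda>_. gaussian_n n 1))"
  by (intro prob_space_PiM prob_space_gaussian_n) simp

lemma sets_design [measurable_cong]:
  "sets (Pi\<^sub>M {..<m} (\<lambda>_. gaussian_n n \<sigma>)) =
   sets (Pi\<^sub>M {..<m} (\<lambda>_. Pi\<^sub>M {..<n} (\<lambda>_. borel)))"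
  by (intro sets_PiM_cong sets_gaussian_n refl)

lemma measurable_observations:
  "(\<lambda>(a, e). (a, observations n m x a e))
     \<in> Pi\<^sub>M {..<m} (\<lambda>_. Pi\<^sub>M {..<n} (\<lambda>_. borel)) \<Otimes>\<^sub>M Pi\<^sub>M {..<m} (\<lambda>_. borel)
       \<rightarrow>\<^sub>M Pi\<^sub>M {..<m} (\<lambda>_. Pi\<^sub>M {..<n} (\<lambda>_. borel)) \<Otimes>\<^sub>M Pi\<^sub>M {..<m} (\<lambda>_. borel)"
proof -
  let ?Q = "Pi\<^sub>M {..<m} (\<lambda>_. Pi\<^sub>M {..<n} (\<lambda>_. borel :: real measure))" and ?Y = "Pi\<^sub>M {..<m} (\<lambda>_. borel :: real measure)"
  have "(\<lambda>p. inner_n n (fst p i) x + snd p i) \<in> borel_measurable (?Q \<Otimes>\<^sub>M ?Y)" if "i \<in> {..<m}" for i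
  proof (rule borel_measurable_add)
    show "(\<lambda>p. inner_n n (fst p i) x) \<in> borel_measurable (?Q \<Otimes>\<^sub>M ?Y)"
      using measurable_compose[OF measurable_fst measurable_compose[OF
          measurable_component_singleton[OF that, of "\<lambda>_. Pi\<^sub>M {..<n} (\<lambda>_. borel)"] measurable_inner_n]] .
    show "(\<lambda>p. snd p i) \<in> borel_measurable (?Q \<Otimes>\<^sub>M ?Y)"
      using measurable_compose[OF measurable_snd measurable_component_singleton[OF that, of "\<lambda>_. borel"]] .
  qed
  then show ?thesis
    unfolding observations_def case_prod_beta'
    by (intro measurable_Pair measurable_fst measurable_restrict)
qed

lemma measurable_distance:
  "(\<lambda>u. norm_n n (diff_n n u x)) \<in> borel_measurable (Pi\<^sub>M {..<n} (\<lambda>_. borel))"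
proof -
  have "(\<lambda>u. norm_n n (diff_n n u x)) = (\<lambda>u. sqrt (\<Sum>i<n. (u i - x i)\<^sup>2))"
    by (simp add: norm_n_def L2_set_def diff_n_def)
  then show ?thesis by simp
qed

lemma measurable_design_inner:
  "i < m \<Longrightarrow> (\<lambda>a. inner_n n (a i) x) \<in> borel_measurable (Pi\<^sub>M {..<m} (\<lambda>_. gaussian_n n 1))"
  by (rule measurable_compose[OF measurable_component_singleton[where M = "\<lambda>_. gaussian_n n 1"]])
     (auto simp: measurable_cong_sets[OF sets_gaussian_n refl])

text \<open>
  The expected energy of the signal \<open>x\<close> in the observations; it controls by Markov's inequality
  the designs that separate the signals too well.
\<close>
lemma nn_integral_design_energy:
  "(\<integral>\<^sup>+a. ennreal (\<Sum>i<m. (inner_n n (a i) x)\<^sup>2) \<partial>Pi\<^sub>M {..<m} (\<lambda>_. gaussian_n n 1))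
     = ennreal (real m * (norm_n n x)\<^sup>2)"
proof -
  let ?Q = "Pi\<^sub>M {..<m} (\<lambda>_. gaussian_n n 1)"
  have "(\<integral>\<^sup>+a. ennreal ((inner_n n (a i) x)\<^sup>2) \<partial>?Q) = ennreal ((norm_n n x)\<^sup>2)" if "i < m" for i
  proof -
    have "(\<integral>\<^sup>+a. ennreal ((inner_n n (a i) x)\<^sup>2) \<partial>?Q)
        = (\<integral>\<^sup>+g. ennreal ((inner_n n g x)\<^sup>2) \<partial>distr ?Q (gaussian_n n 1) (\<lambda>a. a i))"
      using that by (intro nn_integral_distr[symmetric] measurable_component_singleton) auto
    also have "distr ?Q (gaussian_n n 1) (\<lambda>a. a i) = gaussian_n n 1"
      using that by (intro distr_PiM_component prob_space_gaussian_n) auto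
    finally show ?thesis by (simp add: nn_integral_gaussian_inner_square)
  qed
  moreover have "(\<lambda>a. ennreal ((inner_n n (a i) x)\<^sup>2)) \<in> borel_measurable ?Q" if "i < m" for i
    using measurable_design_inner[OF that] by measurable
  ultimately have "(\<integral>\<^sup>+a. (\<Sum>i<m. ennreal ((inner_n n (a i) x)\<^sup>2)) \<partial>?Q) = (\<Sum>i<m. ennreal ((norm_n n x)\<^sup>2))"
    by (subst nn_integral_sum) auto
  then show ?thesis by (simp add: ennreal_mult' ennreal_of_nat_eq_real_of_nat)
qed

text \<open>
  An estimate within \<open>t / 20\<close> of a point of the packing identifies it, since the points are
  \<open>t / 10\<close> apart. For a fixed design the signals that it does not amplify too much (those for which the
  design is not \<open>bad\<close>) obey the testing bound; on average over the design each signal is amplified too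
  much with probability at most \<open>1 / 16\<close>. So the average probability of identification is at most
  \<open>4 / 5 + 1 / 16 \<le> 7 / 8\<close>, and some point of the packing is missed by at least \<open>t / 20\<close> with
  probability at least \<open>1 / 8\<close>.
\<close>
lemma minimax_packing_bound:
  assumes m: "m \<ge> 1" and \<nu>: "\<nu> > 0" and t: "t > 0" and est: "estimator n m xhat"
    and X: "packing n {u \<in> K. norm_n n u \<le> t} (t / 10) X" "finite X" "card X \<ge> 2"
    and snr: "64 * real m * t\<^sup>2 \<le> \<nu>\<^sup>2 * ln (real (card X))"
  shows "\<exists>x\<in>X. ennreal (t / 160) \<le> expected_error n m \<nu> xhat x"
proof -
  let ?Q = "Pi\<^sub>M {..<m} (\<lambda>_. gaussian_n n 1)" and ?G = "gaussian_n m \<nu>"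
  let ?P = "design_noise n m \<nu>"
  interpret Q: prob_space ?Q by (rule prob_space_design)
  interpret G: prob_space ?G by (rule prob_space_gaussian_n[OF \<nu>])
  interpret QG: pair_prob_space ?Q ?G ..
  have P: "?P = ?Q \<Otimes>\<^sub>M ?G" by (simp add: design_noise_def)
  interpret P: prob_space ?P unfolding P by (rule QG.prob_space_axioms)
  define N where "N = real (card X)"
  have N: "N \<ge> 2" using X by (simp add: N_def)
  have lnN: "ln N > 0" using N by simp
  have Xt: "norm_n n x \<le> t" if "x \<in> X" for x using X that by (auto simp: packing_def)
  have sep: "norm_n n (diff_n n x z) \<ge> t / 10" if "x \<in> X" "z \<in> X" "x \<noteq> z" for x z
    using X that by (auto simp: packing_def)
  define err where "err x p = norm_n n (diff_n n (xhat p) x)" for x p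
  have err_meas [measurable]: "err x \<in> borel_measurable (Pi\<^sub>M {..<m} (\<lambda>_. Pi\<^sub>M {..<n} (\<lambda>_. borel)) \<Otimes>\<^sub>M Pi\<^sub>M {..<m} (\<lambda>_. borel))" for x
    unfolding err_def
    by (rule measurable_compose[OF est[unfolded estimator_def] measurable_distance])
  have sets_P [measurable_cong]: "sets ?P = sets (Pi\<^sub>M {..<m} (\<lambda>_. Pi\<^sub>M {..<n} (\<lambda>_. borel)) \<Otimes>\<^sub>M Pi\<^sub>M {..<m} (\<lambda>_. borel))"
    unfolding P by (intro sets_pair_measure_cong sets_design sets_gaussian_n)
  define err_obs where "err_obs x = (\<lambda>(a, e). err x (a, observations n m x a e))" for x
  have err_obs_meas [measurable]: "err_obs x \<in> borel_measurable ?P" for x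
    using measurable_compose[OF measurable_observations err_meas[of x]]
    unfolding measurable_cong_sets[OF sets_P refl] err_obs_def by (simp add: case_prod_beta')
  define success where "success x = {p \<in> space ?P. err_obs x p < t / 20}" for x
  have succ_sets [measurable]: "success x \<in> sets ?P" for x unfolding success_def by measurable
  define bad where "bad x = {a \<in> space ?Q. \<nu>\<^sup>2 * ln N / 4 \<le> (\<Sum>i<m. (inner_n n (a i) x)\<^sup>2)}" for x
  have energy [measurable]: "(\<lambda>a. \<Sum>i<m. (inner_n n (a i) x)\<^sup>2) \<in> borel_measurable ?Q" for x
    by (intro borel_measurable_sum borel_measurable_power measurable_design_inner) auto
  have bad_sets [measurable]: "bad x \<in> sets ?Q" for x unfolding bad_def by measurable
  have bad_prob: "emeasure ?Q (bad x) \<le> ennreal (1 / 16)" if x: "x \<in> X" for x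
  proof -
    let ?c = "\<nu>\<^sup>2 * ln N / 4"
    have c: "?c > 0" using \<nu> lnN by simp
    have "bad x \<subseteq> {a \<in> space ?Q. 1 \<le> ennreal (1 / ?c) * ennreal (\<Sum>i<m. (inner_n n (a i) x)\<^sup>2)}"
      using c unfolding bad_def
      by (auto simp: sum_nonneg field_simps simp flip: ennreal_mult ennreal_1)
    then have "emeasure ?Q (bad x) \<le> emeasure ?Q {a \<in> space ?Q. 1 \<le> ennreal (1 / ?c) * ennreal (\<Sum>i<m. (inner_n n (a i) x)\<^sup>2)}"
      by (rule emeasure_mono) measurable
    also have "\<dots> \<le> ennreal (1 / ?c) * (\<integral>\<^sup>+a. ennreal (\<Sum>i<m. (inner_n n (a i) x)\<^sup>2) * indicator (space ?Q) a \<partial>?Q)"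
      by (rule nn_integral_Markov_inequality) measurable
    also have "(\<integral>\<^sup>+a. ennreal (\<Sum>i<m. (inner_n n (a i) x)\<^sup>2) * indicator (space ?Q) a \<partial>?Q)
        = ennreal (real m * (norm_n n x)\<^sup>2)"
      unfolding nn_integral_design_energy[symmetric] by (rule nn_integral_cong) simp
    also have "ennreal (1 / ?c) * \<dots> = ennreal (1 / ?c * (real m * (norm_n n x)\<^sup>2))"
      using c by (intro ennreal_mult[symmetric]) auto
    also have "\<dots> \<le> ennreal (1 / 16)"
    proof (rule ennreal_leI)
      have "real m * (norm_n n x)\<^sup>2 \<le> real m * t\<^sup>2"
        using Xt[OF x] by (intro mult_left_mono power_mono) auto
      also have "\<dots> \<le> ?c / 16" using snr by (simp add: N_def)
      finally show "1 / ?c * (real m * (norm_n n x)\<^sup>2) \<le> 1 / 16" using c by (simp add: field_simps)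
    qed
    finally show ?thesis .
  qed
  have fixed_design: "(\<Sum>x\<in>X. emeasure ?G (Pair a -` success x))
      \<le> ennreal (4 / 5 * N) + (\<Sum>x\<in>X. indicator (bad x) a)" if a: "a \<in> space ?Q" for a
  proof -
    define A where "A x = {y \<in> space (Pi\<^sub>M {..<m} (\<lambda>_. borel)). err x (a, y) < t / 20}" for x
    have a': "a \<in> space (Pi\<^sub>M {..<m} (\<lambda>_. Pi\<^sub>M {..<n} (\<lambda>_. borel)))"
      using a sets_eq_imp_space_eq[OF sets_design[of m n 1]] by simp
    have A_sets: "A x \<in> sets (Pi\<^sub>M {..<m} (\<lambda>_. borel))" for x
      unfolding A_def using a' by measurable
    have section_eq: "Pair a -` success x = {e \<in> space ?G. (\<lambda>i\<in>{..<m}. inner_n n (a i) x + e i) \<in> A x}" for x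
      using a by (auto simp: success_def A_def err_obs_def observations_def P space_pair_measure space_PiM)
    define J where "J = {x \<in> X. a \<notin> bad x}"
    have J: "finite J" "J \<subseteq> X" using X by (auto simp: J_def)
    have "(\<Sum>x\<in>J. measure ?G (Pair a -` success x)) \<le> sqrt (real (card J)) * exp (ln N / 8)"
      unfolding section_eq
    proof (rule gaussian_testing_bound[where b = "\<lambda>x i. inner_n n (a i) x"])
      show "disjoint_family_on A J"
        unfolding disjoint_family_on_def
      proof (intro ballI impI equals0I)
        fix x z y assume xz: "x \<in> J" "z \<in> J" "x \<noteq> z" and y: "y \<in> A x \<inter> A z"
        have "norm_n n (diff_n n x z) \<le> err x (a, y) + err z (a, y)"
          using norm_n_diff_triangle[of n x z "xhat (a, y)"] by (simp add: err_def norm_n_diff_commute)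
        also have "\<dots> < t / 10" using y by (simp add: A_def)
        finally show False using sep[of x z] xz J by auto
      qed
      show "(\<Sum>i<m. (inner_n n (a i) x)\<^sup>2) \<le> 2 * (ln N / 8) * \<nu>\<^sup>2" if "x \<in> J" for x
        using that a by (auto simp: J_def bad_def not_le mult.commute)
    qed (use \<nu> J A_sets in auto)
    also have "\<dots> \<le> sqrt N * exp (ln N / 8)"
      using card_mono[OF X(2) J(2)] by (intro mult_right_mono) (auto simp: N_def)
    also have "\<dots> \<le> 4 / 5 * N" by (rule sqrt_exp_ln_bound[OF N])
    finally have good: "(\<Sum>x\<in>J. emeasure ?G (Pair a -` success x)) \<le> ennreal (4 / 5 * N)"
      by (simp add: G.emeasure_eq_measure ennreal_leI)
    have "(\<Sum>x\<in>X - J. emeasure ?G (Pair a -` success x)) \<le> (\<Sum>x\<in>X - J. indicator (bad x) a)"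
      by (intro sum_mono) (auto simp: J_def G.emeasure_le_1)
    also have "\<dots> \<le> (\<Sum>x\<in>X. indicator (bad x) a)"
      using X by (intro sum_mono2) auto
    finally have "(\<Sum>x\<in>X - J. emeasure ?G (Pair a -` success x)) \<le> (\<Sum>x\<in>X. indicator (bad x) a)" .
    with good show ?thesis
      by (subst sum.subset_diff[OF J(2) X(2)], subst add.commute) (rule add_mono)
  qed
  have "(\<Sum>x\<in>X. emeasure ?P (success x)) = (\<Sum>x\<in>X. \<integral>\<^sup>+a. emeasure ?G (Pair a -` success x) \<partial>?Q)"
    using succ_sets unfolding P by (intro sum.cong refl G.emeasure_pair_measure_alt)
  also have "\<dots> = (\<integral>\<^sup>+a. (\<Sum>x\<in>X. emeasure ?G (Pair a -` success x)) \<partial>?Q)"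
    using succ_sets unfolding P by (intro nn_integral_sum[symmetric] G.measurable_emeasure_Pair)
  also have "\<dots> \<le> (\<integral>\<^sup>+a. ennreal (4 / 5 * N) + (\<Sum>x\<in>X. indicator (bad x) a) \<partial>?Q)"
    by (intro nn_integral_mono fixed_design)
  also have "\<dots> = ennreal (4 / 5 * N) + (\<Sum>x\<in>X. emeasure ?Q (bad x))"
    by (subst nn_integral_add) (auto simp: nn_integral_sum Q.emeasure_space_1)
  also have "\<dots> \<le> ennreal (4 / 5 * N) + (\<Sum>x\<in>X. ennreal (1 / 16))"
    by (intro add_left_mono sum_mono bad_prob)
  also have "\<dots> = ennreal (4 / 5 * N + N / 16)"
    using N by (simp add: N_def ennreal_of_nat_eq_real_of_nat flip: ennreal_mult' ennreal_plus)
  finally have "(\<Sum>x\<in>X. measure ?P (success x)) \<le> 4 / 5 * N + N / 16"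
    using N by (simp add: P.emeasure_eq_measure sum_nonneg)
  also have "\<dots> \<le> (\<Sum>x\<in>X. 7 / 8)" using N by (simp add: N_def)
  finally have "\<not> (\<forall>x\<in>X. 7 / 8 < measure ?P (success x))"
    using sum_strict_mono[of X "\<lambda>_. 7 / 8" "\<lambda>x. measure ?P (success x)"] X by fastforce
  then obtain x where x: "x \<in> X" "measure ?P (success x) \<le> 7 / 8" by (auto simp: not_less)
  have "t / 160 \<le> t / 20 * (1 - measure ?P (success x))" using x t by simp
  also have "\<dots> = t / 20 * measure ?P (space ?P - success x)" by (simp add: P.prob_compl)
  finally have "ennreal (t / 160) \<le> ennreal (t / 20) * emeasure ?P (space ?P - success x)"
    using t by (simp add: P.emeasure_eq_measure ennreal_leI flip: ennreal_mult)
  also have "\<dots> = (\<integral>\<^sup>+p. ennreal (t / 20) * indicator (space ?P - success x) p \<partial>?P)"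
    by (rule nn_integral_cmult_indicator[symmetric]) measurable
  also have "\<dots> \<le> (\<integral>\<^sup>+p. ennreal (err_obs x p) \<partial>?P)"
    by (intro nn_integral_mono) (auto simp: success_def indicator_def not_less intro!: ennreal_leI)
  also have "\<dots> = expected_error n m \<nu> xhat x"
    by (simp add: expected_error_def err_obs_def err_def case_prod_beta')
  finally show ?thesis using x by blast
qed

section \<open>The critical radius\<close>
text \<open>
  Sudakov's inequality bounds all packings uniformly, since the local mean width is finite. Hence the
  supremum of natural numbers that defines the packing number is a maximum, and not the default value
  of an unbounded supremum.
\<close>
lemma local_packing_attained:
  assumes star: "star_shaped n K" and K: "K \<noteq> {}" and t: "t > 0"
  obtains X where "packing n {u \<in> K. norm_n n u \<le> t} (t / 10) X" "finite X"
    "card X = local_packing_number n K t" "card X \<ge> 1"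
proof -
  let ?T = "{u \<in> K. norm_n n u \<le> t}"
  let ?S = "card ` {X. packing n ?T (t / 10) X}"
  define B where "B = exp ((4000 * local_mean_width n K t / t)\<^sup>2)"
  have "card X \<le> nat \<lceil>B\<rceil>" if X: "packing n ?T (t / 10) X" for X
  proof (cases "card X \<ge> 2")
    case True
    then have fin: "finite X" by (metis card.infinite not_numeral_le_zero)
    have "sqrt (ln (real (card X))) \<le> 4000 * local_mean_width n K t / t"
      using sudakov_minoration_local[OF star t X fin True] t by (simp add: field_simps)
    then have "ln (real (card X)) \<le> (4000 * local_mean_width n K t / t)\<^sup>2"
      by (rule sqrt_le_D)
    then have "exp (ln (real (card X))) \<le> B" unfolding B_def by simp
    then have "real (card X) \<le> B" using True by simp
    then show ?thesis by linarith
  next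
    case False
    have "1 \<le> B" by (simp add: B_def)
    then have "1 \<le> nat \<lceil>B\<rceil>" by linarith
    with False show ?thesis by linarith
  qed
  then have fin: "finite ?S" by (intro finite_subset[of ?S "{..nat \<lceil>B\<rceil>}"]) auto
  obtain k where "k \<in> K" using K by auto
  then have "scale_n n 0 k \<in> ?T"
    using star t by (auto simp: star_shaped_def image_subset_iff norm_n_scale)
  then have "packing n ?T (t / 10) {scale_n n 0 k}" by (simp add: packing_def)
  then have one: "1 \<in> ?S" by (intro image_eqI[of _ _ "{scale_n n 0 k}"]) auto
  have "local_packing_number n K t = Max ?S"
    unfolding local_packing_number_def packing_number_def Sup_nat_def using one by auto
  moreover have "Max ?S \<in> ?S" "1 \<le> Max ?S" using fin one by (auto intro!: Max_in Max_ge)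
  ultimately obtain X where "packing n ?T (t / 10) X" "card X = local_packing_number n K t"
    "card X \<ge> 1" by (metis (no_types, lifting) imageE mem_Collect_eq)
  with that show ?thesis by (metis card.infinite not_one_le_zero)
qed

text \<open>
  The condition of \<open>minimax_packing_bound\<close> holds at the small radius \<open>t1\<close>, where \<open>P\<^sub>t \<ge> 2\<close> suffices for
  it. It fails at large radii: \<open>w\<^sub>t \<le> t E\<parallel>g\<parallel>\<close>, so by Sudakov's inequality \<open>ln P\<^sub>t\<close> is bounded in \<open>t\<close>.
  Doubling \<open>t1\<close> repeatedly therefore crosses the threshold.
\<close>
lemma critical_radius_exists:
  assumes star: "star_shaped n K" and K: "K \<noteq> {}" and m: "m \<ge> 1" and \<nu>: "\<nu> > 0"
    and P: "\<And>t. t > 0 \<Longrightarrow> local_packing_number n K t \<ge> 2"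
  obtains t where "t > 0"
    "64 * real m * t\<^sup>2 \<le> \<nu>\<^sup>2 * ln (real (local_packing_number n K t))"
    "\<nu>\<^sup>2 * ln (real (local_packing_number n K (2 * t))) < 64 * real m * (2 * t)\<^sup>2"
proof -
  define L where "L t = ln (real (local_packing_number n K t))" for t
  define good where "good t \<longleftrightarrow> 64 * real m * t\<^sup>2 \<le> \<nu>\<^sup>2 * L t" for t
  define C where "C = (\<integral>g. norm_n n g \<partial>gaussian_n n 1)"
  have C: "C \<ge> 0" unfolding C_def by (intro integral_nonneg_AE AE_I2) simp
  have good_bounded: "t \<le> 4000 * \<nu> * C" if t: "t > 0" and g: "good t" for t
  proof -
    obtain X where X: "packing n {u \<in> K. norm_n n u \<le> t} (t / 10) X" "finite X"
      "card X = local_packing_number n K t" by (rule local_packing_attained[OF star K t])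
    have "t * sqrt (L t) / 4000 \<le> local_mean_width n K t"
      using sudakov_minoration_local[OF star t X(1,2)] X(3) P[OF t] by (simp add: L_def)
    also have "\<dots> \<le> t * C" unfolding C_def using t K by (intro local_mean_width_le) auto
    finally have "sqrt (L t) \<le> 4000 * C" using t by (simp add: field_simps)
    then have L: "L t \<le> (4000 * C)\<^sup>2" by (rule sqrt_le_D)
    have "t\<^sup>2 \<le> 64 * real m * t\<^sup>2" using m mult_right_mono[of 1 "64 * real m" "t\<^sup>2"] by simp
    also have "\<dots> \<le> \<nu>\<^sup>2 * (4000 * C)\<^sup>2"
      using g L unfolding good_def by (meson mult_left_mono order_trans zero_le_power2)
    finally have "t\<^sup>2 \<le> (4000 * \<nu> * C)\<^sup>2" by (simp add: power_mult_distrib mult_ac)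
    then show ?thesis by (rule power2_le_imp_le) (use \<nu> C in auto)
  qed
  define t1 where "t1 = \<nu> * sqrt (ln 2) / (8 * sqrt (real m))"
  have t1: "t1 > 0" using \<nu> m by (simp add: t1_def)
  have "64 * real m * t1\<^sup>2 = \<nu>\<^sup>2 * ln 2"
    using m by (simp add: t1_def power_divide power_mult_distrib)
  also have "\<dots> \<le> \<nu>\<^sup>2 * L t1" unfolding L_def using P[OF t1] by (intro mult_left_mono) auto
  finally have good0: "good t1" by (simp add: good_def)
  obtain k where k: "4000 * \<nu> * C / t1 < 2 ^ k" using real_arch_pow[of 2] by auto
  then have "4000 * \<nu> * C < 2 ^ k * t1" using t1 by (simp add: field_simps)
  then have "\<not> good (2 ^ k * t1)" using good_bounded[of "2 ^ k * t1"] t1 by fastforce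
  then obtain j where "good (2 ^ j * t1)" "\<not> good (2 ^ Suc j * t1)"
    using ex_least_nat_less[of "\<lambda>k. \<not> good (2 ^ k * t1)" k] good0 by auto
  with that[of "2 ^ j * t1"] t1 show ?thesis by (simp add: good_def L_def not_le mult.assoc)
qed

lemma delta_star_le:
  assumes "K \<noteq> {}" "\<nu> > 0" "t > 0"
  shows "\<delta>_star n m \<nu> K \<le> t + \<nu> / sqrt (real m) * (1 + local_mean_width n K t / t)"
  unfolding \<delta>_star_def
proof (rule cINF_lower)
  show "bdd_below ((\<lambda>t. t + \<nu> / sqrt (real m) * (1 + local_mean_width n K t / t)) ` {0<..})"
    using assms local_mean_width_nonneg[OF assms(1)]
    by (intro bdd_belowI2[of _ 0]) (auto intro!: add_nonneg_nonneg mult_nonneg_nonneg divide_nonneg_nonneg)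
qed (use assms in auto)

theorem corollary4p4:
  "\<exists>c::real. c > 0 \<and>
     (\<forall>(n::nat) (m::nat) (\<nu>::real) (K :: (nat \<Rightarrow> real) set)
       (xhat :: (nat \<Rightarrow> nat \<Rightarrow> real) \<times> (nat \<Rightarrow> real) \<Rightarrow> (nat \<Rightarrow> real)).
        m \<ge> 1 \<longrightarrow> \<nu> > 0 \<longrightarrow>
        K \<noteq> {} \<longrightarrow> closedin (powertop_real {..<n}) K \<longrightarrow> star_shaped n K \<longrightarrow>
        estimator n m xhat \<longrightarrow>
        (SUP x\<in>K. expected_error n m \<nu> xhat x)
          \<ge> c_alpha c n K * min (ennreal (\<delta>_star n m \<nu> K)) (diam_n n K))"
proof (intro exI[of _ "1 / 16000000"] conjI allI impI)
  fix n m :: nat and \<nu> :: real and K :: "(nat \<Rightarrow> real) set"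
    and xhat :: "(nat \<Rightarrow> nat \<Rightarrow> real) \<times> (nat \<Rightarrow> real) \<Rightarrow> (nat \<Rightarrow> real)"
  assume m: "m \<ge> 1" and \<nu>: "\<nu> > 0" and K: "K \<noteq> {}" and star: "star_shaped n K"
    and est: "estimator n m xhat"
  show "c_alpha (1 / 16000000) n K * min (ennreal (\<delta>_star n m \<nu> K)) (diam_n n K)
      \<le> (SUP x\<in>K. expected_error n m \<nu> xhat x)"
  proof (cases "\<alpha>_ratio n K = \<infinity>")
    case True
    then show ?thesis by (simp add: c_alpha_def)
  next
    case False
    define \<alpha> where "\<alpha> = enn2real (\<alpha>_ratio n K)"
    have \<alpha>_eq: "\<alpha>_ratio n K = ennreal \<alpha>" using False by (simp add: \<alpha>_def less_top)
    have \<alpha>0: "\<alpha> \<ge> 0" by (simp add: \<alpha>_def)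
    have ratio: "width_packing_ratio n K t \<le> ennreal \<alpha>" if "t > 0" for t
      unfolding \<alpha>_eq[symmetric] \<alpha>_ratio_def using that by (intro SUP_upper) auto
    have P: "local_packing_number n K t \<ge> 2" if t: "t > 0" for t
    proof -
      have "local_packing_number n K t \<noteq> 1"
        using ratio[OF t] by (auto simp: width_packing_ratio_def top_unique)
      moreover have "local_packing_number n K t \<ge> 1"
        by (rule local_packing_attained[OF star K t]) simp
      ultimately show ?thesis by linarith
    qed
    define L where "L t = sqrt (ln (real (local_packing_number n K t)))" for t
    have L: "L t \<ge> 4 / 5" if t: "t > 0" for t
    proof -
      have "(4 / 5)\<^sup>2 \<le> (2 / 3 :: real)" by (simp add: power_divide)
      also have "\<dots> \<le> ln 2" by (rule ln2_ge_two_thirds)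
      also have "\<dots> \<le> ln (real (local_packing_number n K t))" using P[OF t] by simp
      finally show ?thesis unfolding L_def by (rule real_le_rsqrt)
    qed
    have width: "local_mean_width n K t \<le> \<alpha> * t * L t" if t: "t > 0" for t
    proof -
      have "ennreal (local_mean_width n K t / (t * L t)) \<le> ennreal \<alpha>"
        using ratio[OF t] P[OF t] by (simp add: width_packing_ratio_def L_def split: if_splits)
      then have "local_mean_width n K t / (t * L t) \<le> \<alpha>" using \<alpha>0 by (simp add: ennreal_le_iff)
      moreover have "t * L t > 0" using t L[OF t] by simp
      ultimately show ?thesis by (simp add: pos_divide_le_eq mult.assoc)
    qed
    have \<alpha>: "1 / 4000 \<le> \<alpha>"
    proof -
      obtain X where X: "packing n {u \<in> K. norm_n n u \<le> 1} (1 / 10) X" "finite X"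
        "card X = local_packing_number n K 1"
        using local_packing_attained[OF star K, of 1] by auto
      have "L 1 / 4000 \<le> local_mean_width n K 1"
        using sudakov_minoration_local[OF star _ X(1,2)] X(3) P[of 1] by (simp add: L_def)
      also have "\<dots> \<le> \<alpha> * L 1" using width[of 1] by simp
      finally have "L 1 * (1 / 4000) \<le> L 1 * \<alpha>" by (simp add: mult.commute)
      then show ?thesis using L[of 1] by (subst (asm) mult_le_cancel_left_pos) auto
    qed
    obtain t where t: "t > 0"
      and above: "64 * real m * t\<^sup>2 \<le> \<nu>\<^sup>2 * ln (real (local_packing_number n K t))"
      and below: "\<nu>\<^sup>2 * ln (real (local_packing_number n K (2 * t))) < 64 * real m * (2 * t)\<^sup>2"
      using critical_radius_exists[OF star K m \<nu> P] by blast
    obtain X where X: "packing n {u \<in> K. norm_n n u \<le> t} (t / 10) X" "finite X"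
      "card X = local_packing_number n K t"
      by (rule local_packing_attained[OF star K t])
    obtain x where x: "x \<in> X" "ennreal (t / 160) \<le> expected_error n m \<nu> xhat x"
      using minimax_packing_bound[OF m \<nu> t est X(1,2)] X(3) P[OF t] above by auto
    have xK: "x \<in> K" using x X by (auto simp: packing_def)
    \<comment> \<open>At the radius \<open>2 t\<close> the noise term is dominated by the radius. Both additive constants,
        from the radius and from the \<open>1\<close> in the definition of \<open>\<delta>\<^sup>*\<close>, are absorbed by
        \<open>\<alpha> \<ge> 1 / 4000\<close>.\<close>
    have delta: "\<delta>_star n m \<nu> K \<le> 88016 * \<alpha> * t"
    proof -
      let ?u = "2 * t"
      have u: "?u > 0" using t by simp
      have sm: "sqrt (real m) > 0" using m by simp
      have Lu: "L ?u \<ge> 4 / 5" by (rule L[OF u])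
      have "(\<nu> * L ?u)\<^sup>2 = \<nu>\<^sup>2 * ln (real (local_packing_number n K ?u))"
        using P[OF u] by (simp add: power_mult_distrib L_def)
      also have "\<dots> \<le> (8 * sqrt (real m) * ?u)\<^sup>2"
        using below by (simp add: power_mult_distrib)
      finally have "\<nu> * L ?u \<le> 8 * sqrt (real m) * ?u"
        by (rule power2_le_imp_le) (use t in auto)
      then have noise: "\<nu> / sqrt (real m) * L ?u \<le> 8 * ?u" using sm by (simp add: field_simps)
      have "local_mean_width n K ?u / ?u \<le> \<alpha> * L ?u"
        using width[OF u] u by (simp add: field_simps)
      then have "1 + local_mean_width n K ?u / ?u \<le> L ?u * (5 / 4 + \<alpha>)"
        using Lu by (simp add: algebra_simps)
      then have "\<nu> / sqrt (real m) * (1 + local_mean_width n K ?u / ?u)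
          \<le> \<nu> / sqrt (real m) * (L ?u * (5 / 4 + \<alpha>))"
        using \<nu> by (intro mult_left_mono) auto
      also have "\<dots> = (\<nu> / sqrt (real m) * L ?u) * (5 / 4 + \<alpha>)" by simp
      also have "\<dots> \<le> 8 * ?u * (5 / 4 + \<alpha>)" using noise \<alpha>0 by (intro mult_right_mono) auto
      finally have "\<delta>_star n m \<nu> K \<le> ?u + 8 * ?u * (5 / 4 + \<alpha>)"
        using delta_star_le[OF K \<nu> u, of n m] by linarith
      also have "\<dots> = t * (22 + 16 * \<alpha>)" by (simp add: algebra_simps)
      also have "\<dots> \<le> t * (88016 * \<alpha>)" using \<alpha> t by (intro mult_left_mono) auto
      finally show ?thesis by (simp add: mult_ac)
    qed
    have "c_alpha (1 / 16000000) n K * min (ennreal (\<delta>_star n m \<nu> K)) (diam_n n K)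
        \<le> c_alpha (1 / 16000000) n K * ennreal (88016 * \<alpha> * t)"
      using delta by (intro mult_left_mono min.coboundedI1 ennreal_leI) auto
    also have "\<dots> = ennreal (1 / 16000000 / \<alpha> * (88016 * \<alpha> * t))"
      unfolding c_alpha_def \<alpha>_eq using \<alpha> t
      by (subst divide_ennreal) (auto simp flip: ennreal_mult)
    also have "\<dots> \<le> ennreal (t / 160)"
      using \<alpha> t by (intro ennreal_leI) auto
    also have "\<dots> \<le> expected_error n m \<nu> xhat x" by (rule x)
    also have "\<dots> \<le> (SUP x\<in>K. expected_error n m \<nu> xhat x)" by (rule SUP_upper[OF xK])
    finally show ?thesis .
  qed
qed simp

end
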